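(* Let $T$ be a bounded linear operator on a separable infinite-dimensional Banach space $X$, and assume that $T$ admits an ergodic Borel probability measure with full support. Then the set of distributionally irregular vectors for $T$ is comeager in $X$. In particular this holds if $X$ is a complex Banach space and $T$ has a perfectly spanning set of unimodular eigenvectors.
   Context: A vector $x\in X$ is distributionally irregular for $T$ if there exist sets $A,B\subset\mathbb N$, both of upper density $1$ (upper density $\overline{\mathrm{dens}}(D)=\limsup_N\frac1N\#(D\cap[1,N])$), such that $\|T^ix\|\to0$ as $i\to\infty$, $i\in A$, and $\|T^ix\|\to\infty$ as $i\to\infty$, $i\in B$. A unimodular eigenvector is an eigenvector whose eigenvalue has modulus $1$. $T$ has a perfectly spanning set of unimodular eigenvectors if for every countable $D\subset\mathbb T$, $\overline{\mathrm{span}}\,[\ker(T-\lambda I):\lambda\in\mathbb T\setminus D]=X$. *)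

theory Defs
  imports "HOL-Probability.Probability"
begin

definition upper_density :: "nat set \<Rightarrow> ereal" where
  "upper_density D = limsup (\<lambda>N. ereal (real (card (D \<inter> {1..N})) / real N))"

definition distr_irregular :: "('a::real_normed_vector \<Rightarrow> 'a) \<Rightarrow> 'a \<Rightarrow> bool" where
  "distr_irregular T x \<longleftrightarrow>
     (\<exists>A B. upper_density A = 1 \<and> upper_density B = 1 \<and>
        ((\<lambda>i. norm ((T ^^ i) x)) \<longlongrightarrow> 0) (sequentially \<sqinter> principal A) \<and>
        filterlim (\<lambda>i. norm ((T ^^ i) x)) at_top (sequentially \<sqinter> principal B))"

definition nowhere_dense :: "'a::topological_space set \<Rightarrow> bool" where
  "nowhere_dense N \<longleftrightarrow> interior (closure N) = {}"

definition meager :: "'a::topological_space set \<Rightarrow> bool" where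
  "meager S \<longleftrightarrow> (\<exists>F::nat \<Rightarrow> 'a set. (\<forall>n. nowhere_dense (F n)) \<and> S \<subseteq> (\<Union>n. F n))"

definition comeager :: "'a::topological_space set \<Rightarrow> bool" where
  "comeager S \<longleftrightarrow> meager (- S)"

definition ergodic_full_support :: "('a::topological_space \<Rightarrow> 'a) \<Rightarrow> 'a measure \<Rightarrow> bool" where
  "ergodic_full_support T M \<longleftrightarrow>
     prob_space M \<and> sets M = sets borel \<and>
     (\<forall>A\<in>sets M. measure M (T -` A) = measure M A) \<and>
     (\<forall>A\<in>sets M. T -` A = A \<longrightarrow> measure M A = 0 \<or> measure M A = 1) \<and>
     (\<forall>U. open U \<and> U \<noteq> {} \<longrightarrow> measure M U > 0)"

text \<open>A complex scalar multiplication extending the real one, making the real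
  Banach space a complex Banach space.\<close>
definition complex_structure :: "(complex \<Rightarrow> 'a::real_normed_vector \<Rightarrow> 'a) \<Rightarrow> bool" where
  "complex_structure sc \<longleftrightarrow>
     (\<forall>r x. sc (complex_of_real r) x = r *\<^sub>R x) \<and>
     (\<forall>a x y. sc a (x + y) = sc a x + sc a y) \<and>
     (\<forall>a b x. sc (a + b) x = sc a x + sc b x) \<and>
     (\<forall>a b x. sc a (sc b x) = sc (a * b) x) \<and>
     (\<forall>a x. norm (sc a x) = cmod a * norm x)"

text \<open>Perfectly spanning set of unimodular eigenvectors. The eigenspaces are complex
  subspaces, so their complex and real linear spans coincide.\<close>
definition perfectly_spanning ::
  "(complex \<Rightarrow> 'a::real_normed_vector \<Rightarrow> 'a) \<Rightarrow> ('a \<Rightarrow> 'a) \<Rightarrow> bool" where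
  "perfectly_spanning sc T \<longleftrightarrow>
     (\<forall>D::complex set. countable D \<longrightarrow>
        closure (span (\<Union>l\<in>{z. cmod z = 1} - D. {x. T x = sc l x})) = UNIV)"

end

theory Submission
  imports Defs
begin

text \<open>
  By Baire category it suffices that, for every \<open>e > 0\<close> and \<open>K\<close>, densely many \<open>x\<close> have
  arbitrarily long initial orbit segments with \<open>norm (T\<^sup>i x) < e\<close> for a proportion of at least
  \<open>1 - e\<close> of the times \<open>i\<close>, and likewise with \<open>norm (T\<^sup>i x) > K\<close>.

  Let \<open>m\<close> be ergodic with full support. For a Borel set \<open>E\<close>, the set where the upper frequency
  of visits to \<open>E\<close> exceeds a given \<open>c < m E\<close> is invariant and, by Fatou's lemma, not null, so it has
  full measure (the pointwise ergodic theorem is not needed). Apply this to \<open>E\<close> a large ball or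
  the complement of a small ball and dilate: the dilates of \<open>m\<close> concentrate near \<open>0\<close> or near
  infinity, yet their typical points are still dense.

  In the case of perfectly spanning eigenvectors no invariant measure is needed either. Outside a
  countable set of eigenvalues, every unimodular eigenvector \<open>x\<close> is approximated by the average
  \<open>y\<close> of \<open>n\<close> eigenvectors close to \<open>x\<close> with distinct eigenvalues \<open>l\<^sub>1, \<dots>, l\<^sub>n\<close>. Then \<open>T\<^sup>i y\<close> is
  close to a scalar multiple of \<open>x\<close>, the scalar being the mean of the \<open>l\<^sub>j\<^sup>i\<close> over \<open>j\<close>, and
  the average over \<open>i\<close> of its squared modulus tends to \<open>1 / n\<close>. The vectors approximable by such mostly small orbits form a closed subspace, hence
  everything. The vectors \<open>x - y\<close> are themselves small but have mostly large orbits.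
\<close>

section \<open>A Baire category criterion\<close>

text \<open>Diagonal choice: take rapidly growing times \<open>N k\<close> such that
  \<open>P k\<close> fails at a proportion of at most \<open>1 / Suc k\<close> of the times up to
  \<open>N (Suc k)\<close>, and let \<open>A\<close> demand \<open>P k i\<close> only once
  \<open>i\<close> has passed \<open>N k\<close>. Each \<open>P k\<close> then holds eventually
  along \<open>A\<close>, while the density of \<open>A\<close> is close to 1 along the subsequence
  \<open>N (Suc k)\<close>.\<close>

lemma upper_density_diagonal:
  fixes P :: "nat \<Rightarrow> nat \<Rightarrow> bool"
  assumes anti: "\<And>k i. P (Suc k) i \<Longrightarrow> P k i"
    and few: "\<And>k. \<exists>N>k. card {i \<in> {1..N}. \<not> P k i} * Suc k \<le> N"
  shows "\<exists>A. upper_density A = 1 \<and> (\<forall>k. \<forall>\<^sub>F i in sequentially \<sqinter> principal A. P k i)"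
proof -
  have anti': "P l i" if "P k i" "l \<le> k" for k l i
    using that(2,1) by (induction rule: inc_induct) (auto intro: anti)
  have "\<exists>y. Suc n * x < y \<and> card {i \<in> {1..y}. \<not> P n i} * Suc n \<le> y" for n x :: nat
  proof -
    \<comment> \<open>The hypothesis gives just one time beyond each index. Using it at an index
      this large yields a time beyond \<open>Suc n * x\<close>, and antitonicity brings
      \<open>P k\<close> and the factor \<open>Suc k\<close> back to level \<open>n\<close>.\<close>
    define k where "k = n + Suc n * x"
    obtain y where y: "y > k" "card {i \<in> {1..y}. \<not> P k i} * Suc k \<le> y"
      using few by blast
    have "card {i \<in> {1..y}. \<not> P n i} \<le> card {i \<in> {1..y}. \<not> P k i}"
      by (intro card_mono) (auto intro: anti' simp: k_def)
    then have "card {i \<in> {1..y}. \<not> P n i} * Suc n \<le> card {i \<in> {1..y}. \<not> P k i} * Suc k"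
      by (intro mult_le_mono) (auto simp: k_def)
    with y show ?thesis by (intro exI[of _ y]) (auto simp: k_def)
  qed
  then have "\<exists>N. \<forall>k. True \<and>
      (Suc k * N k < N (Suc k) \<and> card {i \<in> {1..N (Suc k)}. \<not> P k i} * Suc k \<le> N (Suc k))"
    by (intro dependent_nat_choice) simp_all
  then obtain N :: "nat \<Rightarrow> nat" where N: "\<And>k. Suc k * N k < N (Suc k)"
    "\<And>k. card {i \<in> {1..N (Suc k)}. \<not> P k i} * Suc k \<le> N (Suc k)"
    by blast
  have "N k < N (Suc k)" for k
    using N(1)[of k] by simp
  then have mono: "strict_mono N"
    by (simp add: strict_mono_Suc_iff)
  define A where "A = {i. \<forall>k. N k < i \<longrightarrow> P k i}"
  define d where "d = (\<lambda>n. real (card (A \<inter> {1..n})) / real n)"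
  have d_le: "d n \<le> 1" for n
    using card_mono[of "{1..n}" "A \<inter> {1..n}"] by (auto simp: d_def divide_simps)
  have d_ge: "1 - 2 * inverse (real (Suc k)) \<le> d (N (Suc k))" for k
  proof -
    let ?N = "N (Suc k)" and ?B = "{i \<in> {1..N (Suc k)}. \<not> P k i}"
    have pos: "0 < ?N" using N(1)[of k] by simp
    have "{1..?N} \<subseteq> (A \<inter> {1..?N}) \<union> ?B \<union> {1..N k}"
    proof
      fix i assume i: "i \<in> {1..?N}"
      \<comment> \<open>Up to \<open>N (Suc k)\<close> only the conditions with index at most
        \<open>k\<close> are active, and \<open>P k i\<close> implies all of them.\<close>
      have "i \<in> A" if "P k i"
        unfolding A_def
      proof (intro CollectI allI impI)
        fix j assume "N j < i"
        with i have "N j < N (Suc k)" by auto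
        then have "j \<le> k" using mono by (simp add: strict_mono_less)
        with that show "P j i" by (rule anti')
      qed
      with i show "i \<in> (A \<inter> {1..?N}) \<union> ?B \<union> {1..N k}" by auto
    qed
    then have "?N \<le> card ((A \<inter> {1..?N}) \<union> ?B \<union> {1..N k})"
      using card_mono[of "(A \<inter> {1..?N}) \<union> ?B \<union> {1..N k}" "{1..?N}"] by simp
    also have "\<dots> \<le> card (A \<inter> {1..?N}) + card ?B + N k"
      using card_Un_le[of "(A \<inter> {1..?N}) \<union> ?B" "{1..N k}"] card_Un_le[of "A \<inter> {1..?N}" ?B]
      by simp
    finally have "real ?N \<le> real (card (A \<inter> {1..?N})) + real (card ?B) + real (N k)"
      by linarith
    moreover have "real (card ?B) \<le> real ?N / real (Suc k)"
    proof -
      have "real (card ?B * Suc k) \<le> real ?N" using N(2)[of k] by (rule of_nat_mono)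
      then show ?thesis by (simp only: of_nat_mult) (simp add: field_simps)
    qed
    moreover have "real (N k) \<le> real ?N / real (Suc k)"
    proof -
      have "real (Suc k * N k) \<le> real ?N" using N(1)[of k] by (intro of_nat_mono) simp
      then show ?thesis by (simp only: of_nat_mult) (simp add: field_simps)
    qed
    ultimately have "real ?N - 2 * (real ?N / real (Suc k)) \<le> real (card (A \<inter> {1..?N}))"
      by linarith
    then have "(real ?N - 2 * (real ?N / real (Suc k))) / real ?N \<le> d ?N"
      unfolding d_def by (rule divide_right_mono) simp
    moreover have "(real ?N - 2 * (real ?N / real (Suc k))) / real ?N = 1 - 2 * inverse (real (Suc k))"
      using pos by (simp add: diff_divide_distrib inverse_eq_divide)
    ultimately show ?thesis by simp
  qed
  have "(\<lambda>k. d (N (Suc k))) \<longlonglongrightarrow> 1"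
  proof (rule tendsto_sandwich)
    have "(\<lambda>k. 1 - 2 * inverse (real (Suc k))) \<longlonglongrightarrow> 1 - 2 * 0"
      by (intro tendsto_intros LIMSEQ_inverse_real_of_nat)
    then show "(\<lambda>k. 1 - 2 * inverse (real (Suc k))) \<longlonglongrightarrow> 1" by simp
  qed (use d_ge d_le in auto)
  then have "((\<lambda>n. ereal (d n)) \<circ> (N \<circ> Suc)) \<longlonglongrightarrow> ereal 1"
    by (simp add: o_def)
  then have "limsup ((\<lambda>n. ereal (d n)) \<circ> (N \<circ> Suc)) = 1"
    by (simp add: lim_imp_Limsup)
  moreover have "strict_mono (N \<circ> Suc)"
    using mono by (auto simp: strict_mono_def)
  ultimately have "1 \<le> limsup (\<lambda>n. ereal (d n))"
    using limsup_subseq_mono by metis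
  moreover have "limsup (\<lambda>n. ereal (d n)) \<le> 1"
    by (rule Limsup_bounded) (simp add: d_le)
  ultimately have "upper_density A = 1"
    by (simp add: upper_density_def d_def)
  moreover have "\<forall>\<^sub>F i in sequentially \<sqinter> principal A. P k i" for k
    unfolding eventually_inf_principal using eventually_gt_at_top[of "N k"]
    by eventually_elim (simp add: A_def)
  ultimately show ?thesis by blast
qed

section \<open>Comeager sets and irregular vectors\<close>

lemma meager_Un:
  assumes "meager A" "meager B"
  shows "meager (A \<union> B)"
proof -
  obtain F G where FG: "\<And>n. nowhere_dense (F n)" "A \<subseteq> (\<Union>n::nat. F n)"
     "\<And>n. nowhere_dense (G n)" "B \<subseteq> (\<Union>n::nat. G n)"
    using assms unfolding meager_def by metis
  define H where "H n = (if even n then F (n div 2) else G (n div 2))" for n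
  have "F n = H (2 * n)" "G n = H (2 * n + 1)" for n by (auto simp: H_def)
  then have "(\<Union>n. F n) \<subseteq> (\<Union>n. H n)" "(\<Union>n. G n) \<subseteq> (\<Union>n. H n)" by auto
  with FG(2,4) have "A \<union> B \<subseteq> (\<Union>n. H n)" by (meson Un_least subset_trans)
  moreover have "nowhere_dense (H n)" for n using FG by (simp add: H_def)
  ultimately show ?thesis unfolding meager_def by blast
qed

lemma comeager_Int: "comeager A \<Longrightarrow> comeager B \<Longrightarrow> comeager (A \<inter> B)"
  by (simp add: comeager_def meager_Un)

lemma comeager_superset: "comeager A \<Longrightarrow> A \<subseteq> B \<Longrightarrow> comeager B"
  unfolding comeager_def meager_def by (meson Compl_subset_Compl_iff subset_trans)

text \<open>Sorting the points by a set \<open>S\<close> of times at which failure is allowed gives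
  a union of finite intersections of open sets.\<close>

lemma open_few_failures:
  fixes P :: "nat \<Rightarrow> 'a::topological_space \<Rightarrow> bool"
  assumes "\<And>i. open {x. P i x}"
  shows "open {x. card {i \<in> {1..N}. \<not> P i x} \<le> c}"
proof -
  have "{x. card {i \<in> {1..N}. \<not> P i x} \<le> c} =
      (\<Union>S\<in>{S. S \<subseteq> {1..N} \<and> card S \<le> c}. \<Inter>i\<in>{1..N} - S. {x. P i x})"
  proof (intro equalityI subsetI)
    fix x assume "x \<in> {x. card {i \<in> {1..N}. \<not> P i x} \<le> c}"
    then show "x \<in> (\<Union>S\<in>{S. S \<subseteq> {1..N} \<and> card S \<le> c}. \<Inter>i\<in>{1..N} - S. {x. P i x})"
      by (intro UN_I[of "{i \<in> {1..N}. \<not> P i x}"]) auto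
  next
    fix x assume "x \<in> (\<Union>S\<in>{S. S \<subseteq> {1..N} \<and> card S \<le> c}. \<Inter>i\<in>{1..N} - S. {x. P i x})"
    then obtain S where S: "S \<subseteq> {1..N}" "card S \<le> c" "\<forall>i\<in>{1..N} - S. P i x" by auto
    then have "card {i \<in> {1..N}. \<not> P i x} \<le> card S"
      by (intro card_mono) (auto intro: finite_subset)
    with S(2) show "x \<in> {x. card {i \<in> {1..N}. \<not> P i x} \<le> c}" by simp
  qed
  also have "open \<dots>"
    using assms by (intro open_UN ballI open_INT) auto
  finally show ?thesis .
qed

lemma comeager_upper_density_one:
  fixes P :: "nat \<Rightarrow> nat \<Rightarrow> 'a::topological_space \<Rightarrow> bool"
  assumes op: "\<And>k i. open {x. P k i x}"
    and anti: "\<And>k i x. P (Suc k) i x \<Longrightarrow> P k i x"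
    and dense: "\<And>k U. open U \<Longrightarrow> U \<noteq> {} \<Longrightarrow>
      \<exists>x\<in>U. \<exists>N>k. real (card {i \<in> {1..N}. \<not> P k i x}) \<le> real N / real (Suc k)"
  shows "comeager {x. \<exists>A. upper_density A = 1 \<and>
      (\<forall>k. \<forall>\<^sub>F i in sequentially \<sqinter> principal A. P k i x)}" (is "comeager ?S")
proof -
  define G where "G k = {x. \<exists>N>k. card {i \<in> {1..N}. \<not> P k i x} * Suc k \<le> N}" for k
  have G_open: "open (G k)" for k
  proof -
    \<comment> \<open>Integer division turns the proportion into a bound on the number of failures,
      the form that \<open>open_few_failures\<close> handles.\<close>
    have "G k = (\<Union>N\<in>{k<..}. {x. card {i \<in> {1..N}. \<not> P k i x} \<le> N div Suc k})"
      by (auto simp: G_def less_eq_div_iff_mult_less_eq simp del: mult_Suc_right)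
    also have "open \<dots>" by (intro open_UN ballI open_few_failures op)
    finally show ?thesis .
  qed
  have "nowhere_dense (- G k)" for k
  proof -
    have "interior (- G k) = {}"
    proof (rule ccontr)
      assume "interior (- G k) \<noteq> {}"
      then obtain x N where x: "x \<in> interior (- G k)" "N > k"
        "real (card {i \<in> {1..N}. \<not> P k i x}) \<le> real N / real (Suc k)"
        using dense[OF open_interior] by metis
      from x(3) have "real (card {i \<in> {1..N}. \<not> P k i x}) * real (Suc k) \<le> real N"
        by (simp add: pos_le_divide_eq)
      then have "card {i \<in> {1..N}. \<not> P k i x} * Suc k \<le> N"
        by (metis of_nat_mult of_nat_le_iff)
      with x(2) have "x \<in> G k" by (auto simp: G_def)
      with x(1) interior_subset show False by blast
    qed
    moreover have "closed (- G k)" using G_open by (simp add: closed_Compl)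
    ultimately show ?thesis by (simp add: nowhere_dense_def closure_closed)
  qed
  moreover have "x \<in> ?S" if "\<And>k. x \<in> G k" for x
    using that upper_density_diagonal[of "\<lambda>k i. P k i x"] anti by (simp add: G_def)
  then have "- ?S \<subseteq> (\<Union>k. - G k)" by blast
  ultimately show ?thesis
    unfolding comeager_def meager_def by (intro exI[of _ "\<lambda>k. - G k"]) simp
qed

text \<open>Smallness and largeness are treated separately, with thresholds \<open>1 / Suc k\<close>
  and \<open>Suc k\<close>. A vector in both comeager sets has its own set of times for each, which
  are the \<open>A\<close> and \<open>B\<close> of the definition.\<close>

lemma comeager_distr_irregular:
  fixes T :: "'a::real_normed_vector \<Rightarrow> 'a"
  assumes cont: "\<And>i. continuous_on UNIV (T ^^ i)"
    and small: "\<And>U n e. \<lbrakk>open U; U \<noteq> {}; 0 < e\<rbrakk> \<Longrightarrow>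
      \<exists>x\<in>U. \<exists>N>n. real (card {i \<in> {1..N}. \<not> norm ((T ^^ i) x) < e}) \<le> e * real N"
    and large: "\<And>U n e K. \<lbrakk>open U; U \<noteq> {}; 0 < e; 0 < K\<rbrakk> \<Longrightarrow>
      \<exists>x\<in>U. \<exists>N>n. real (card {i \<in> {1..N}. \<not> K < norm ((T ^^ i) x)}) \<le> e * real N"
  shows "comeager {x. distr_irregular T x}"
proof -
  let ?Small = "{x. \<exists>A. upper_density A = 1 \<and> (\<forall>k. \<forall>\<^sub>F i in sequentially \<sqinter> principal A.
      norm ((T ^^ i) x) < 1 / real (Suc k))}"
  let ?Large = "{x. \<exists>B. upper_density B = 1 \<and> (\<forall>k. \<forall>\<^sub>F i in sequentially \<sqinter> principal B.
      real (Suc k) < norm ((T ^^ i) x))}"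
  have "comeager ?Small"
  proof (rule comeager_upper_density_one)
    show "open {x. norm ((T ^^ i) x) < 1 / real (Suc k)}" for k i
      by (intro open_Collect_less continuous_intros cont)
    show "norm ((T ^^ i) x) < 1 / real (Suc k)" if "norm ((T ^^ i) x) < 1 / real (Suc (Suc k))" for k i x
      using that by (rule less_trans) (simp add: divide_simps)
    show "\<exists>x\<in>U. \<exists>N>k. real (card {i \<in> {1..N}. \<not> norm ((T ^^ i) x) < 1 / real (Suc k)})
        \<le> real N / real (Suc k)" if "open U" "U \<noteq> {}" for k U
      using small[OF that, of "1 / real (Suc k)" k] by simp
  qed
  moreover have "comeager ?Large"
  proof (rule comeager_upper_density_one)
    show "open {x. real (Suc k) < norm ((T ^^ i) x)}" for k i
      by (intro open_Collect_less continuous_intros cont)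
    show "\<exists>x\<in>U. \<exists>N>k. real (card {i \<in> {1..N}. \<not> real (Suc k) < norm ((T ^^ i) x)})
        \<le> real N / real (Suc k)" if "open U" "U \<noteq> {}" for k U
      using large[OF that, of "1 / real (Suc k)" "real (Suc k)" k] by simp
  qed auto
  ultimately have "comeager (?Small \<inter> ?Large)" by (rule comeager_Int)
  moreover have "?Small \<inter> ?Large \<subseteq> {x. distr_irregular T x}"
  proof clarify
    fix x A B
    assume A: "upper_density A = 1" "\<forall>k. \<forall>\<^sub>F i in sequentially \<sqinter> principal A.
        norm ((T ^^ i) x) < 1 / real (Suc k)"
      and B: "upper_density B = 1" "\<forall>k. \<forall>\<^sub>F i in sequentially \<sqinter> principal B.
        real (Suc k) < norm ((T ^^ i) x)"
    have "((\<lambda>i. norm ((T ^^ i) x)) \<longlongrightarrow> 0) (sequentially \<sqinter> principal A)"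
    proof (rule tendstoI)
      fix e :: real assume "0 < e"
      then obtain k where "inverse (real (Suc k)) < e" using reals_Archimedean by blast
      then have "1 / real (Suc k) < e" by (simp add: inverse_eq_divide)
      then show "\<forall>\<^sub>F i in sequentially \<sqinter> principal A. dist (norm ((T ^^ i) x)) 0 < e"
        using A(2)[rule_format, of k] by (auto elim!: eventually_mono)
    qed
    moreover have "filterlim (\<lambda>i. norm ((T ^^ i) x)) at_top (sequentially \<sqinter> principal B)"
      unfolding filterlim_at_top
    proof
      fix Z :: real
      obtain k where "Z < real k" using reals_Archimedean2 by blast
      then show "\<forall>\<^sub>F i in sequentially \<sqinter> principal B. Z \<le> norm ((T ^^ i) x)"
        using B(2)[rule_format, of k] by (auto elim!: eventually_mono)
    qed
    ultimately show "distr_irregular T x"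
      unfolding distr_irregular_def using A(1) B(1) by blast
  qed
  ultimately show ?thesis by (rule comeager_superset)
qed

lemma bounded_linear_funpow:
  fixes T :: "'a::real_normed_vector \<Rightarrow> 'a"
  assumes "bounded_linear T"
  shows "bounded_linear (T ^^ i)"
proof (induction i)
  case (Suc i)
  then show ?case using bounded_linear_compose[OF assms] by (simp add: o_def)
qed (simp add: id_def)

section \<open>Perfectly spanning unimodular eigenvectors\<close>

text \<open>For \<open>z\<close> other than 1 the geometric sums stay bounded by
  \<open>2 / cmod (1 - z)\<close>, so division by \<open>N\<close> sends them to 0.\<close>

lemma mean_powers_unimodular:
  fixes z :: complex
  assumes "cmod z = 1"
  shows "(\<lambda>N. (\<Sum>i=1..N. z ^ i) / of_nat N) \<longlonglongrightarrow> (if z = 1 then 1 else 0)"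
proof (cases "z = 1")
  case True
  have "\<forall>\<^sub>F N in sequentially. 1 = (\<Sum>i=1..N. z ^ i) / of_nat N"
    using eventually_gt_at_top[of 0] by eventually_elim (simp add: True)
  then have "(\<lambda>N. (\<Sum>i=1..N. z ^ i) / of_nat N) \<longlonglongrightarrow> 1"
    by (rule Lim_transform_eventually[OF tendsto_const])
  with True show ?thesis by simp
next
  case False
  have "(\<lambda>N. (\<Sum>i=1..N. z ^ i) / of_nat N) \<longlonglongrightarrow> 0"
  proof (rule Lim_null_comparison)
    show "(\<lambda>N. (2 / cmod (1 - z)) / real N) \<longlonglongrightarrow> 0"
      by (rule lim_const_over_n)
    have "cmod (\<Sum>i=1..N. z ^ i) \<le> 2 / cmod (1 - z)" for N
    proof -
      have "cmod (z ^ 1 - z ^ Suc N) \<le> cmod (z ^ 1) + cmod (z ^ Suc N)"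
        by (rule norm_triangle_ineq4)
      then have "cmod (z ^ 1 - z ^ Suc N) \<le> 2"
        by (simp add: norm_power norm_mult assms)
      then show ?thesis
        using False by (simp add: sum_gp norm_divide divide_right_mono)
    qed
    then have "norm ((\<Sum>i=1..N. z ^ i) / of_nat N) \<le> (2 / cmod (1 - z)) / real N" for N
      unfolding norm_divide norm_of_nat by (rule divide_right_mono) simp
    then show "\<forall>\<^sub>F N in sequentially.
        norm ((\<Sum>i=1..N. z ^ i) / of_nat N) \<le> (2 / cmod (1 - z)) / real N"
      by simp
  qed
  with False show ?thesis by simp
qed

text \<open>Orthogonality of characters: expanding the square gives the powers of
  \<open>l * cnj m\<close>, whose means tend to 1 for \<open>l = m\<close> and to 0 otherwise. Only
  the \<open>card L\<close> diagonal terms survive.\<close>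

lemma second_moment_unimodular:
  fixes L :: "complex set"
  assumes "finite L" and uni: "\<And>l. l \<in> L \<Longrightarrow> cmod l = 1"
  shows "(\<lambda>N. (\<Sum>i=1..N. (cmod (\<Sum>l\<in>L. l ^ i))\<^sup>2) / real N) \<longlonglongrightarrow> real (card L)"
proof -
  have expand: "complex_of_real ((\<Sum>i=1..N. (cmod (\<Sum>l\<in>L. l ^ i))\<^sup>2) / real N) =
      (\<Sum>l\<in>L. \<Sum>m\<in>L. (\<Sum>i=1..N. (l * cnj m) ^ i) / of_nat N)" for N
  proof -
    have "complex_of_real (\<Sum>i=1..N. (cmod (\<Sum>l\<in>L. l ^ i))\<^sup>2) =
        (\<Sum>i=1..N. \<Sum>l\<in>L. \<Sum>m\<in>L. (l * cnj m) ^ i)"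
      by (simp add: complex_norm_square[unfolded of_real_power] sum_product power_mult_distrib)
    also have "\<dots> = (\<Sum>l\<in>L. \<Sum>i=1..N. \<Sum>m\<in>L. (l * cnj m) ^ i)"
      by (rule sum.swap)
    also have "\<dots> = (\<Sum>l\<in>L. \<Sum>m\<in>L. \<Sum>i=1..N. (l * cnj m) ^ i)"
      by (intro sum.cong refl sum.swap)
    finally show ?thesis
      by (simp only: of_real_divide of_real_of_nat_eq sum_divide_distrib[symmetric])
  qed
  have ratio: "l * cnj m = 1 \<longleftrightarrow> l = m" if "l \<in> L" "m \<in> L" for l m
  proof
    assume "l * cnj m = 1"
    then have "l * (m * cnj m) = m" by (simp add: algebra_simps)
    moreover have "m * cnj m = 1"
      using uni[OF that(2)] complex_norm_square[of m] by simp
    ultimately show "l = m" by simp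
  next
    assume "l = m"
    then show "l * cnj m = 1"
      using uni[OF that(2)] complex_norm_square[of m] by simp
  qed
  have "(\<lambda>N. \<Sum>l\<in>L. \<Sum>m\<in>L. (\<Sum>i=1..N. (l * cnj m) ^ i) / of_nat N)
      \<longlonglongrightarrow> (\<Sum>l\<in>L. \<Sum>m\<in>L. if l * cnj m = 1 then 1 else 0)"
    by (intro tendsto_sum mean_powers_unimodular) (simp add: norm_mult uni)
  also have "(\<Sum>l\<in>L. \<Sum>m\<in>L. if l * cnj m = 1 then 1 else 0) =
      (\<Sum>l\<in>L. \<Sum>m\<in>L. if l = m then 1 else (0::complex))"
    by (intro sum.cong refl) (simp add: ratio)
  also have "\<dots> = complex_of_real (real (card L))"
    using \<open>finite L\<close> by simp
  finally show ?thesis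
    unfolding expand[symmetric] tendsto_of_real_iff .
qed

section \<open>The closed subspace of limits of vectors with mostly small orbits\<close>

text \<open>A single \<open>e\<close> bounds both the norm and the proportion of exceptional times,
  as in convergence in measure. Asking for all large \<open>N\<close>, rather than infinitely many,
  lets the conditions for two vectors be used at a common \<open>N\<close>.\<close>

definition mostly_small :: "('a::real_normed_vector \<Rightarrow> 'a) \<Rightarrow> real \<Rightarrow> 'a \<Rightarrow> bool" where
  "mostly_small T e y \<longleftrightarrow> (\<forall>\<^sub>F N in sequentially.
     real (card {i \<in> {1..N}. \<not> norm ((T ^^ i) y) < e}) \<le> e * real N)"

definition mostly_small_limits :: "('a::real_normed_vector \<Rightarrow> 'a) \<Rightarrow> 'a set" where
  "mostly_small_limits T = {x. \<forall>e>0. \<exists>y. norm (y - x) < e \<and> mostly_small T e y}"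

lemma mostly_smallI:
  assumes "mostly_small T d y" "d \<le> e" "\<And>i. norm ((T ^^ i) y) < d \<Longrightarrow> norm ((T ^^ i) z) < e"
  shows "mostly_small T e z"
  unfolding mostly_small_def using assms(1)[unfolded mostly_small_def]
proof eventually_elim
  case (elim N)
  have "card {i \<in> {1..N}. \<not> norm ((T ^^ i) z) < e} \<le> card {i \<in> {1..N}. \<not> norm ((T ^^ i) y) < d}"
    using assms(3) by (intro card_mono) auto
  moreover have "d * real N \<le> e * real N"
    using assms(2) by (intro mult_right_mono) auto
  ultimately show ?case using elim by linarith
qed

lemma subspace_mostly_small_limits:
  fixes T :: "'a::real_normed_vector \<Rightarrow> 'a"
  assumes T: "bounded_linear T"
  shows "subspace (mostly_small_limits T)"
  unfolding subspace_def
proof (intro conjI ballI allI)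
  have lin: "linear (T ^^ i)" for i
    using bounded_linear_funpow[OF T] by (rule bounded_linear.linear)
  show "0 \<in> mostly_small_limits T"
    unfolding mostly_small_limits_def mostly_small_def
    by (auto intro!: exI[of _ 0] simp: linear_0[OF lin])
  show "x + y \<in> mostly_small_limits T"
    if xy: "x \<in> mostly_small_limits T" "y \<in> mostly_small_limits T" for x y
    unfolding mostly_small_limits_def
  proof (intro CollectI allI impI)
    fix e :: real assume "e > 0"
    then have "e / 2 > 0" by simp
    then obtain u v where u: "norm (u - x) < e / 2" "mostly_small T (e / 2) u"
      and v: "norm (v - y) < e / 2" "mostly_small T (e / 2) v"
      using xy unfolding mostly_small_limits_def by blast
    have "norm (u + v - (x + y)) < e"
      using norm_triangle_ineq[of "u - x" "v - y"] u(1) v(1) by (simp add: algebra_simps)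
    moreover have "mostly_small T e (u + v)"
      unfolding mostly_small_def using u(2)[unfolded mostly_small_def] v(2)[unfolded mostly_small_def]
    proof eventually_elim
      case (elim N)
      let ?bad = "\<lambda>z e. {i \<in> {1..N}. \<not> norm ((T ^^ i) z) < e}"
      \<comment> \<open>If the sum reaches \<open>e\<close>, one of the summands reaches
        \<open>e / 2\<close>. The two exceptional proportions therefore add up to at most
        \<open>e\<close>.\<close>
      have "?bad (u + v) e \<subseteq> ?bad u (e / 2) \<union> ?bad v (e / 2)"
      proof
        fix i assume "i \<in> ?bad (u + v) e"
        then show "i \<in> ?bad u (e / 2) \<union> ?bad v (e / 2)"
          using norm_triangle_ineq[of "(T ^^ i) u" "(T ^^ i) v"]
          by (auto simp: linear_add[OF lin])
      qed
      then have "card (?bad (u + v) e) \<le> card (?bad u (e / 2) \<union> ?bad v (e / 2))"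
        by (intro card_mono) auto
      also have "\<dots> \<le> card (?bad u (e / 2)) + card (?bad v (e / 2))"
        by (rule card_Un_le)
      finally show ?case using elim by (simp add: field_simps)
    qed
    ultimately show "\<exists>z. norm (z - (x + y)) < e \<and> mostly_small T e z" by blast
  qed
  show "c *\<^sub>R x \<in> mostly_small_limits T" if x: "x \<in> mostly_small_limits T" for c x
    unfolding mostly_small_limits_def
  proof (intro CollectI allI impI)
    fix e :: real assume e: "e > 0"
    \<comment> \<open>The added 1 covers \<open>c = 0\<close> and makes \<open>d\<close> at most
      \<open>e\<close>, so that the exceptional proportion is controlled as well as the
      norm.\<close>
    define d where "d = e / (\<bar>c\<bar> + 1)"
    have d: "d > 0" "d \<le> e" "\<bar>c\<bar> * d < e"
      using e by (auto simp: d_def field_simps add_nonneg_pos)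
    obtain y where y: "norm (y - x) < d" "mostly_small T d y"
      using x d(1) unfolding mostly_small_limits_def by blast
    have shrink: "\<bar>c\<bar> * norm w < e" if "norm w < d" for w :: 'a
      using mult_left_mono[of "norm w" d "\<bar>c\<bar>"] that d(3) by simp
    have "norm (c *\<^sub>R y - c *\<^sub>R x) < e"
      using shrink[OF y(1)] by (simp flip: scaleR_diff_right)
    moreover have "mostly_small T e (c *\<^sub>R y)"
      using y(2) d(2) by (rule mostly_smallI) (simp add: linear_cmul[OF lin] shrink)
    ultimately show "\<exists>z. norm (z - c *\<^sub>R x) < e \<and> mostly_small T e z" by blast
  qed
qed

lemma closed_mostly_small_limits:
  "closed (mostly_small_limits (T :: 'a::real_normed_vector \<Rightarrow> 'a))"
proof -
  have "x \<in> mostly_small_limits T" if x: "x \<in> closure (mostly_small_limits T)" for x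
    unfolding mostly_small_limits_def
  proof (intro CollectI allI impI)
    fix e :: real assume e: "e > 0"
    then have e2: "e / 2 > 0" by simp
    then obtain x' where x': "x' \<in> mostly_small_limits T" "dist x' x < e / 2"
      using x unfolding closure_approachable by blast
    then obtain y where y: "norm (y - x') < e / 2" "mostly_small T (e / 2) y"
      using e2 unfolding mostly_small_limits_def by blast
    have "norm (y - x) < e"
      using norm_triangle_ineq[of "y - x'" "x' - x"] y(1) x'(2) by (simp add: dist_norm)
    moreover have "mostly_small T e y"
      using y(2) by (rule mostly_smallI) (use e in auto)
    ultimately show "\<exists>y. norm (y - x) < e \<and> mostly_small T e y" by blast
  qed
  then have "closure (mostly_small_limits T) \<subseteq> mostly_small_limits T" by blast
  then show ?thesis by (simp only: closure_subset_eq)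
qed

section \<open>Approximation by averages of eigenvectors with distinct eigenvalues\<close>

lemma funpow_eigenvector:
  assumes sc: "complex_structure sc" and comm: "\<And>c x. T (sc c x) = sc c (T x)"
    and x: "T x = sc l x"
  shows "(T ^^ i) x = sc (l ^ i) x"
proof (induction i)
  case 0
  have "sc (complex_of_real 1) x = 1 *\<^sub>R x" using sc unfolding complex_structure_def by blast
  then show ?case by simp
next
  case (Suc i)
  have "sc (l ^ i) (sc l x) = sc (l ^ i * l) x" using sc unfolding complex_structure_def by blast
  with Suc show ?case by (simp add: comm x mult.commute)
qed

text \<open>Average \<open>m\<close> eigenvectors lying within \<open>e / 2\<close> of
  \<open>x\<close>, with distinct eigenvalues. Along the orbit the differences
  \<open>X l - x\<close> contribute at most \<open>e / 2\<close>, and \<open>x\<close> is multiplied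
  by the mean of the \<open>l ^ i\<close>. By Chebyshev's inequality and the second moment, that
  mean has modulus below \<open>h\<close> at most times.\<close>

lemma mostly_small_limit_if_accumulated:
  fixes T :: "'a::real_normed_vector \<Rightarrow> 'a"
  assumes T: "bounded_linear T" and sc: "complex_structure sc"
    and comm: "\<And>c x. T (sc c x) = sc c (T x)"
    and acc: "\<And>U. open U \<Longrightarrow> x \<in> U \<Longrightarrow> infinite {l. cmod l = 1 \<and> (\<exists>y\<in>U. T y = sc l y)}"
  shows "x \<in> mostly_small_limits T"
  unfolding mostly_small_limits_def
proof (intro CollectI allI impI)
  fix e :: real assume e: "e > 0"
  have add_left: "sc (a + b) v = sc a v + sc b v"
    and diff_right: "sc a (v - w) = sc a v - sc a w"
    and norm_sc: "norm (sc a v) = cmod a * norm v" for a b v w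
  proof -
    show "sc (a + b) v = sc a v + sc b v" "norm (sc a v) = cmod a * norm v"
      using sc unfolding complex_structure_def by blast+
    have "sc a (v - w + w) = sc a (v - w) + sc a w"
      using sc unfolding complex_structure_def by blast
    then show "sc a (v - w) = sc a v - sc a w" by (simp add: algebra_simps)
  qed
  define h where "h = e / (2 * (norm x + 1))"
  have nx: "norm x + 1 > 0" by (simp add: add_nonneg_pos)
  have h: "h > 0" "h * norm x < e / 2"
    using e nx by (auto simp: h_def field_simps)
  \<comment> \<open>Chebyshev will bound the proportion of times with
    \<open>cmod (\<Sum>l\<in>L. l ^ i) \<ge> h * m\<close> by
    \<open>2 * m / (h * m)\<^sup>2\<close>, which is below \<open>e\<close> for this
    \<open>m\<close>. The factor 2 is the slack left because the second moment equals
    \<open>m\<close> only in the limit.\<close>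
  obtain m :: nat where m: "2 / (h\<^sup>2 * e) < real m"
    using reals_Archimedean2 by blast
  moreover have "2 / (h\<^sup>2 * e) > 0" using h(1) e by simp
  ultimately have m0: "real m > 0" by linarith
  have inf: "infinite {l. cmod l = 1 \<and> (\<exists>y\<in>ball x (e / 2). T y = sc l y)}"
    using e by (intro acc) auto
  obtain L where L: "finite L" "card L = m" "L \<subseteq> {l. cmod l = 1 \<and> (\<exists>y\<in>ball x (e / 2). T y = sc l y)}"
    using infinite_arbitrarily_large[OF inf] by blast
  then have "\<forall>l\<in>L. \<exists>y. y \<in> ball x (e / 2) \<and> T y = sc l y" by blast
  then obtain X where X: "\<And>l. l \<in> L \<Longrightarrow> X l \<in> ball x (e / 2) \<and> T (X l) = sc l (X l)"
    by metis
  have uni: "cmod l = 1" if "l \<in> L" for l using L(3) that by auto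
  have near: "norm (X l - x) \<le> e / 2" if "l \<in> L" for l
    using X[OF that] by (simp add: dist_norm norm_minus_commute)
  define y where "y = (1 / real m) *\<^sub>R (\<Sum>l\<in>L. X l)"
  have orbit: "(T ^^ i) y = (1 / real m) *\<^sub>R (sc (\<Sum>l\<in>L. l ^ i) x + (\<Sum>l\<in>L. sc (l ^ i) (X l - x)))" for i
  proof -
    have lin: "linear (T ^^ i)"
      using bounded_linear_funpow[OF T] by (rule bounded_linear.linear)
    have sum_left: "sc (\<Sum>l\<in>L. l ^ i) x = (\<Sum>l\<in>L. sc (l ^ i) x)"
    proof -
      have "Modules.additive (\<lambda>a. sc a x)" by (simp add: Modules.additive_def add_left)
      then show ?thesis by (rule Modules.additive.sum)
    qed
    have "(T ^^ i) y = (1 / real m) *\<^sub>R (\<Sum>l\<in>L. (T ^^ i) (X l))"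
      by (simp only: y_def linear_cmul[OF lin] linear_sum[OF lin])
    also have "(\<Sum>l\<in>L. (T ^^ i) (X l)) = (\<Sum>l\<in>L. sc (l ^ i) (X l))"
      using X by (intro sum.cong refl funpow_eigenvector[OF sc comm]) auto
    also have "\<dots> = sc (\<Sum>l\<in>L. l ^ i) x + (\<Sum>l\<in>L. sc (l ^ i) (X l - x))"
      unfolding sum_left by (simp add: diff_right sum_subtractf)
    finally show ?thesis .
  qed
  have err: "norm (\<Sum>l\<in>L. sc (l ^ i) (X l - x)) \<le> real m * (e / 2)" for i
  proof -
    have "norm (\<Sum>l\<in>L. sc (l ^ i) (X l - x)) \<le> (\<Sum>l\<in>L. e / 2)"
      using near by (intro sum_norm_le) (simp add: norm_sc norm_power uni)
    then show ?thesis by (simp add: L(2))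
  qed
  have orbit_small: "norm ((T ^^ i) y) < e" if "cmod (\<Sum>l\<in>L. l ^ i) < h * real m" for i
  proof -
    have "norm (sc (\<Sum>l\<in>L. l ^ i) x + (\<Sum>l\<in>L. sc (l ^ i) (X l - x)))
        \<le> cmod (\<Sum>l\<in>L. l ^ i) * norm x + real m * (e / 2)"
      unfolding norm_sc[symmetric] by (rule norm_triangle_le[OF add_left_mono[OF err]])
    also have "cmod (\<Sum>l\<in>L. l ^ i) * norm x \<le> (h * real m) * norm x"
      using that by (intro mult_right_mono) auto
    also have "\<dots> = (h * norm x) * real m" by simp
    also have "\<dots> < e / 2 * real m" using h(2) m0 by (intro mult_strict_right_mono)
    finally have "norm (sc (\<Sum>l\<in>L. l ^ i) x + (\<Sum>l\<in>L. sc (l ^ i) (X l - x))) < e * real m"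
      by (simp add: algebra_simps)
    then show ?thesis using m0 by (simp add: orbit pos_divide_less_eq)
  qed
  have "norm (y - x) < e"
  proof -
    have "y - x = (1 / real m) *\<^sub>R (\<Sum>l\<in>L. X l - x)"
      using m0 by (simp add: y_def sum_subtractf scaleR_diff_right L(2) sum_constant_scaleR)
    also have "norm \<dots> \<le> (1 / real m) * (\<Sum>l\<in>L. e / 2)"
      unfolding norm_scaleR using near m0 by (intro mult_mono sum_norm_le) auto
    also have "\<dots> < e" using m0 e by (simp add: L(2))
    finally show ?thesis .
  qed
  moreover have "mostly_small T e y"
    unfolding mostly_small_def
  proof -
    have "(\<lambda>N. (\<Sum>i=1..N. (cmod (\<Sum>l\<in>L. l ^ i))\<^sup>2) / real N) \<longlonglongrightarrow> real m"
      using second_moment_unimodular[OF L(1) uni] L(2) by simp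
    then have "\<forall>\<^sub>F N in sequentially. (\<Sum>i=1..N. (cmod (\<Sum>l\<in>L. l ^ i))\<^sup>2) / real N < 2 * real m"
      using m0 by (intro order_tendstoD) auto
    then show "\<forall>\<^sub>F N in sequentially.
        real (card {i \<in> {1..N}. \<not> norm ((T ^^ i) y) < e}) \<le> e * real N"
      using eventually_gt_at_top[of 0]
    proof eventually_elim
      case (elim N)
      let ?bad = "{i \<in> {1..N}. \<not> norm ((T ^^ i) y) < e}"
      have "real (card ?bad) * (h * real m)\<^sup>2 = (\<Sum>i\<in>?bad. (h * real m)\<^sup>2)" by simp
      also have "\<dots> \<le> (\<Sum>i\<in>?bad. (cmod (\<Sum>l\<in>L. l ^ i))\<^sup>2)"
      proof (rule sum_mono)
        fix i assume "i \<in> ?bad"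
        then have "\<not> cmod (\<Sum>l\<in>L. l ^ i) < h * real m" using orbit_small[of i] by auto
        then show "(h * real m)\<^sup>2 \<le> (cmod (\<Sum>l\<in>L. l ^ i))\<^sup>2"
          using h(1) m0 by (intro power_mono) auto
      qed
      also have "\<dots> \<le> (\<Sum>i=1..N. (cmod (\<Sum>l\<in>L. l ^ i))\<^sup>2)"
        by (intro sum_mono2) auto
      also have "\<dots> \<le> 2 * real m * real N"
        using elim by (simp add: field_simps)
      finally have "real (card ?bad) * (h\<^sup>2 * real m) * real m \<le> 2 * real N * real m"
        by (simp add: power2_eq_square algebra_simps)
      then have 1: "real (card ?bad) * (h\<^sup>2 * real m) \<le> 2 * real N"
        using m0 by simp
      have "2 \<le> e * (h\<^sup>2 * real m)"
        using m h(1) e by (simp add: field_simps)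
      then have "2 * real N \<le> e * real N * (h\<^sup>2 * real m)"
        using mult_right_mono[of 2 "e * (h\<^sup>2 * real m)" "real N"] by (simp add: algebra_simps)
      with 1 have "real (card ?bad) * (h\<^sup>2 * real m) \<le> e * real N * (h\<^sup>2 * real m)" by linarith
      moreover have "h\<^sup>2 * real m > 0" using h(1) m0 by simp
      ultimately show ?case by (simp only: mult_le_cancel_right_pos)
    qed
  qed
  ultimately show "\<exists>y. norm (y - x) < e \<and> mostly_small T e y" by blast
qed

text \<open>\<open>D\<close> collects the eigenvalues occurring in those basic open sets that meet
  eigenspaces for only countably many of them. A countable base makes \<open>D\<close> countable,
  and an eigenvalue outside \<open>D\<close> cannot occur in any such basic set.\<close>

lemma uncountable_eigenvalues_near:
  fixes T :: "'a::{real_normed_vector, second_countable_topology} \<Rightarrow> 'a"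
  obtains D :: "complex set" where "countable D"
    "\<And>l x U. \<lbrakk>cmod l = 1; l \<notin> D; T x = sc l x; open U; x \<in> U\<rbrakk> \<Longrightarrow>
       uncountable {l. cmod l = 1 \<and> (\<exists>y\<in>U. T y = sc l y)}"
proof -
  let ?E = "\<lambda>U. {l. cmod l = 1 \<and> (\<exists>y\<in>U. T y = sc l y)}"
  obtain \<B> :: "'a set set" where \<B>: "countable \<B>" "topological_basis \<B>"
    using ex_countable_basis by blast
  define D where "D = (\<Union>U\<in>{U\<in>\<B>. countable (?E U)}. ?E U)"
  have "countable D"
    unfolding D_def using \<B>(1) by (intro countable_UN) auto
  moreover have "uncountable (?E U)"
    if l: "cmod l = 1" "l \<notin> D" "T x = sc l x" and U: "open U" "x \<in> U" for l x U
  proof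
    assume "countable (?E U)"
    obtain V where V: "V \<in> \<B>" "x \<in> V" "V \<subseteq> U"
      using topological_basisE[OF \<B>(2) U] by blast
    have "countable (?E V)"
      using V(3) by (intro countable_subset[OF _ \<open>countable (?E U)\<close>]) auto
    moreover have "l \<in> ?E V" using l V(2) by auto
    ultimately have "l \<in> D" using V(1) unfolding D_def by blast
    with l(2) show False ..
  qed
  ultimately show ?thesis by (rule that)
qed

text \<open>Vectors with mostly small orbits are dense. For large orbits, start from such a vector
  \<open>y\<close> and add a multiple of \<open>v - w\<close>, where \<open>v\<close> is a nonzero
  unimodular eigenvector and \<open>w\<close> is a nearby vector with mostly small orbit. The orbit
  of \<open>v\<close> has constant norm, so that of \<open>v - w\<close> mostly stays away from 0
  however close \<open>w\<close> is to \<open>v\<close>.\<close>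

lemma comeager_distr_irregular_perfectly_spanning:
  fixes T :: "'a::{real_normed_vector, second_countable_topology} \<Rightarrow> 'a"
  assumes T: "bounded_linear T" and sc: "complex_structure sc"
    and comm: "\<And>c x. T (sc c x) = sc c (T x)" and span: "perfectly_spanning sc T"
    and nontriv: "(UNIV :: 'a set) \<noteq> {0}"
  shows "comeager {x. distr_irregular T x}"
proof -
  obtain D where D: "countable D" "\<And>l x U. \<lbrakk>cmod l = 1; l \<notin> D; T x = sc l x; open U; x \<in> U\<rbrakk> \<Longrightarrow>
       uncountable {l. cmod l = 1 \<and> (\<exists>y\<in>U. T y = sc l y)}"
    using uncountable_eigenvalues_near by blast
  let ?V = "\<Union>l\<in>{z. cmod z = 1} - D. {x. T x = sc l x}"
  have dense: "closure (span ?V) = UNIV"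
    using span D(1) unfolding perfectly_spanning_def by blast
  have "?V \<subseteq> mostly_small_limits T"
  proof
    fix x assume "x \<in> ?V"
    then obtain l where l: "cmod l = 1" "l \<notin> D" "T x = sc l x" by blast
    show "x \<in> mostly_small_limits T"
      by (rule mostly_small_limit_if_accumulated[OF T sc comm]) (auto dest: D(2)[OF l] countable_finite)
  qed
  then have "span ?V \<subseteq> mostly_small_limits T"
    by (rule span_minimal[OF _ subspace_mostly_small_limits[OF T]])
  then have "closure (span ?V) \<subseteq> mostly_small_limits T"
    using closed_mostly_small_limits by (rule closure_minimal)
  with dense have approx: "\<exists>y. norm (y - x) < e \<and> mostly_small T e y" if "e > 0" for x e
    using that unfolding mostly_small_limits_def by blast
  have "\<exists>x\<in>?V. x \<noteq> 0"
  proof (rule ccontr)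
    assume "\<not> (\<exists>x\<in>?V. x \<noteq> 0)"
    then have "?V \<subseteq> {0}" by blast
    then have "span ?V \<subseteq> {0}" using span_mono[of ?V "{0}"] by simp
    then have "closure (span ?V) \<subseteq> {0}" by (rule closure_minimal) simp
    with dense nontriv show False by auto
  qed
  then obtain v l where v: "v \<noteq> 0" "cmod l = 1" "T v = sc l v" by blast
  have norm_v: "norm ((T ^^ i) v) = norm v" for i
  proof -
    have "norm (sc (l ^ i) v) = cmod (l ^ i) * norm v"
      using sc unfolding complex_structure_def by blast
    then show ?thesis by (simp add: funpow_eigenvector[OF sc comm v(3)] norm_power v(2))
  qed
  show ?thesis
  proof (rule comeager_distr_irregular)
    show "continuous_on UNIV (T ^^ i)" for i
      using bounded_linear_funpow[OF T] by (rule linear_continuous_on)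
  next
    fix U :: "'a set" and n :: nat and e :: real
    assume "open U" "U \<noteq> {}" "0 < e"
    then obtain u r where r: "r > 0" "ball u r \<subseteq> U"
      by (meson all_not_in_conv openE)
    define d where "d = min e r"
    have d: "d > 0" "d \<le> e" "d \<le> r" using \<open>0 < e\<close> r by (auto simp: d_def)
    obtain y where y: "norm (y - u) < d" "mostly_small T d y" using approx[OF d(1)] by blast
    have "mostly_small T e y" using y(2) d(2) by (rule mostly_smallI) (use d in auto)
    then have "\<forall>\<^sub>F N in sequentially. n < N \<and>
        real (card {i \<in> {1..N}. \<not> norm ((T ^^ i) y) < e}) \<le> e * real N"
      unfolding mostly_small_def using eventually_gt_at_top[of n] by eventually_elim simp
    then obtain N where "n < N" "real (card {i \<in> {1..N}. \<not> norm ((T ^^ i) y) < e}) \<le> e * real N"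
      using eventually_happens'[OF sequentially_bot] by blast
    moreover have "y \<in> U" using r(2) y(1) d(3) by (auto simp: dist_norm norm_minus_commute)
    ultimately show "\<exists>x\<in>U. \<exists>N>n. real (card {i \<in> {1..N}. \<not> norm ((T ^^ i) x) < e}) \<le> e * real N"
      by blast
  next
    fix U :: "'a set" and n :: nat and e K :: real
    assume "open U" "U \<noteq> {}" "0 < e" "0 < K"
    then obtain u r where r: "r > 0" "ball u r \<subseteq> U"
      by (meson all_not_in_conv openE)
    define d where "d = Min {e / 2, r / 2, 1}"
    have d: "d > 0" "d \<le> e / 2" "d \<le> r / 2" "d \<le> 1" using \<open>0 < e\<close> r by (auto simp: d_def)
    \<comment> \<open>Where the orbit of \<open>w\<close> is small, that of
      \<open>s *\<^sub>R (v - w)\<close> has norm at least \<open>K + 2\<close>, and subtracting the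
      at most 1 due to \<open>y\<close> still leaves more than \<open>K\<close>.\<close>
    define s where "s = 2 * (K + 2) / norm v"
    have s: "s > 0" "s * (norm v / 2) = K + 2" using v(1) \<open>0 < K\<close> by (auto simp: s_def)
    \<comment> \<open>The three bounds serve the exceptional proportion, the displacement
      \<open>s * c \<le> r / 2\<close> inside the ball, and the lower bound
      \<open>norm v / 2\<close> on the orbit of \<open>v - w\<close>. Since \<open>s\<close> is
      fixed beforehand, \<open>c\<close> may depend on it.\<close>
    define c where "c = Min {e / 2, r / (2 * s), norm v / 2}"
    have c: "c > 0" "c \<le> e / 2" "c \<le> r / (2 * s)" "c \<le> norm v / 2"
      using \<open>0 < e\<close> r s(1) v(1) by (auto simp: c_def)
    obtain y where y: "norm (y - u) < d" "mostly_small T d y" using approx[OF d(1)] by blast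
    obtain w where w: "norm (w - v) < c" "mostly_small T c w" using approx[OF c(1)] by blast
    define x where "x = y + s *\<^sub>R (v - w)"
    have "norm (x - u) \<le> norm (y - u) + s * norm (v - w)"
      using norm_triangle_ineq[of "y - u" "s *\<^sub>R (v - w)"] s(1)
      by (simp add: x_def add_diff_eq diff_add_eq)
    moreover have "s * norm (v - w) < r / 2"
    proof -
      have "s * norm (v - w) < s * c"
        using w(1) s(1) by (simp add: norm_minus_commute)
      also have "\<dots> \<le> r / 2" using c(3) s(1) by (simp add: field_simps)
      finally show ?thesis .
    qed
    ultimately have "norm (x - u) < r" using y(1) d(3) by simp
    then have "x \<in> U" using r(2) by (auto simp: dist_norm norm_minus_commute)
    have big: "K < norm ((T ^^ i) x)" if "norm ((T ^^ i) y) < d" "norm ((T ^^ i) w) < c" for i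
    proof -
      have lin: "linear (T ^^ i)"
        using bounded_linear_funpow[OF T] by (rule bounded_linear.linear)
      have "norm v - c \<le> norm ((T ^^ i) v - (T ^^ i) w)"
        using norm_triangle_ineq2[of "(T ^^ i) v" "(T ^^ i) w"] norm_v[of i] that(2) by linarith
      then have "norm v / 2 \<le> norm ((T ^^ i) v - (T ^^ i) w)" using c(4) by linarith
      then have "s * (norm v / 2) \<le> norm (s *\<^sub>R ((T ^^ i) v - (T ^^ i) w))"
        using s(1) by (simp only: norm_scaleR abs_of_pos mult_le_cancel_left_pos)
      then have "K + 2 \<le> norm (s *\<^sub>R ((T ^^ i) v - (T ^^ i) w))" using s(2) by simp
      moreover have "(T ^^ i) x = (T ^^ i) y + s *\<^sub>R ((T ^^ i) v - (T ^^ i) w)"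
        by (simp add: x_def linear_add[OF lin] linear_cmul[OF lin] linear_diff[OF lin])
      ultimately show ?thesis
        using norm_triangle_ineq2[of "s *\<^sub>R ((T ^^ i) v - (T ^^ i) w)" "- (T ^^ i) y"] that(1) d(4)
        by (simp add: add.commute)
    qed
    have "\<forall>\<^sub>F N in sequentially. n < N \<and>
        real (card {i \<in> {1..N}. \<not> K < norm ((T ^^ i) x)}) \<le> e * real N"
      using y(2)[unfolded mostly_small_def] w(2)[unfolded mostly_small_def] eventually_gt_at_top[of n]
    proof eventually_elim
      case (elim N)
      let ?Y = "{i \<in> {1..N}. \<not> norm ((T ^^ i) y) < d}" and ?W = "{i \<in> {1..N}. \<not> norm ((T ^^ i) w) < c}"
      have "card {i \<in> {1..N}. \<not> K < norm ((T ^^ i) x)} \<le> card (?Y \<union> ?W)"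
        using big by (intro card_mono) auto
      also have "\<dots> \<le> card ?Y + card ?W" by (rule card_Un_le)
      finally have "real (card {i \<in> {1..N}. \<not> K < norm ((T ^^ i) x)}) \<le> d * real N + c * real N"
        using elim by linarith
      also have "\<dots> \<le> e * real N"
        using d(2) c(2) mult_right_mono[of "d + c" e "real N"] by (simp add: algebra_simps)
      finally show ?case using elim by simp
    qed
    then show "\<exists>x\<in>U. \<exists>N>n. real (card {i \<in> {1..N}. \<not> K < norm ((T ^^ i) x)}) \<le> e * real N"
      using eventually_happens'[OF sequentially_bot] \<open>x \<in> U\<close> by blast
  qed
qed

section \<open>Ergodic measures of full support\<close>

lemma measure_preserving_funpow:
  assumes "T \<in> measurable M M" "space M = UNIV"
    and inv: "\<And>A. A \<in> sets M \<Longrightarrow> measure M (T -` A) = measure M A"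
    and "A \<in> sets M"
  shows "measure M ((T ^^ i) -` A) = measure M A"
proof (induction i)
  case (Suc i)
  have "(T ^^ i) \<in> measurable M M" using assms(1) by (rule measurable_compose_n)
  then have "(T ^^ i) -` A \<in> sets M"
    using measurable_sets[of "T ^^ i" M M A] assms(2,4) by simp
  have "(T ^^ Suc i) -` A = T -` ((T ^^ i) -` A)"
    by (simp add: funpow_Suc_right vimage_comp del: funpow.simps)
  then show ?case using inv[OF \<open>(T ^^ i) -` A \<in> sets M\<close>] Suc by (simp only:)
qed simp

text \<open>Were the invariant set \<open>G\<close> null, the frequency \<open>c N x / N\<close> of
  times spent outside \<open>E\<close> would almost surely have lower limit at least some
  \<open>q\<close> above the measure of \<open>- E\<close>. For every positive \<open>N\<close> its
  integral is exactly that measure, so Fatou's lemma forbids this, and ergodicity gives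
  \<open>G\<close> full measure.\<close>

lemma ergodic_frequent_visits:
  fixes T :: "'a \<Rightarrow> 'a"
  assumes "prob_space M" and space: "space M = UNIV" and T[measurable]: "T \<in> measurable M M"
    and inv: "\<And>A. A \<in> sets M \<Longrightarrow> measure M (T -` A) = measure M A"
    and erg: "\<And>A. A \<in> sets M \<Longrightarrow> T -` A = A \<Longrightarrow> measure M A = 0 \<or> measure M A = 1"
    and E[measurable]: "E \<in> sets M" and E_large: "1 - d < measure M E"
  shows "AE x in M. \<exists>\<^sub>F N in sequentially. real (card {i \<in> {1..N}. (T ^^ i) x \<notin> E}) \<le> d * real N"
proof -
  interpret prob_space M by fact
  define c where "c N x = (\<Sum>i=1..N. indicator (- E) ((T ^^ i) x) :: real)" for N x
  have c_card: "c N x = real (card {i \<in> {1..N}. (T ^^ i) x \<notin> E})" for N x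
  proof -
    have "c N x = (\<Sum>i\<in>{1..N}. if (T ^^ i) x \<notin> E then 1 else 0)"
      unfolding c_def by (intro sum.cong) (auto simp: indicator_def)
    then show ?thesis by (simp add: sum.If_cases Int_def)
  qed
  have E'[measurable]: "- E \<in> sets M"
    using sets.compl_sets[OF E] by (simp add: space Compl_eq_Diff_UNIV)
  have Tn[measurable]: "(T ^^ i) \<in> measurable M M" for i
    using T by (rule measurable_compose_n)
  have c_meas[measurable]: "c N \<in> borel_measurable M" for N
    unfolding c_def by measurable
  have shift: "\<bar>c N (T x) - c N x\<bar> \<le> 1" for N x
  proof -
    have "c N (T x) = (\<Sum>i=1..N. indicator (- E) ((T ^^ Suc i) x))"
      by (simp add: c_def funpow_swap1)
    also have "\<dots> - c N x = (\<Sum>i=1..N. indicator (- E) ((T ^^ Suc i) x) - indicator (- E) ((T ^^ i) x))"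
      by (simp add: c_def sum_subtractf)
    also have "\<dots> = indicator (- E) ((T ^^ Suc N) x) - indicator (- E) ((T ^^ 1) x)"
      by (rule sum_Suc_diff) simp
    finally show ?thesis by (simp add: indicator_def)
  qed
  \<comment> \<open>The slack \<open>1 / real (Suc n)\<close> under an existential quantifier makes
    \<open>G\<close> strictly invariant, as the ergodicity hypothesis requires: moving from
    \<open>x\<close> to \<open>T x\<close> changes the counts by at most 1, which replacing
    \<open>n\<close> by \<open>Suc n\<close> absorbs for large \<open>N\<close>.\<close>
  define G where "G = {x. \<exists>n. \<exists>\<^sub>F N in sequentially. c N x \<le> (d - 1 / real (Suc n)) * real N}"
  have G_transfer: "y \<in> G" if "x \<in> G" "\<And>N. c N y \<le> c N x + 1" for x y
  proof -
    obtain n where n: "\<exists>\<^sub>F N in sequentially. c N x \<le> (d - 1 / real (Suc n)) * real N"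
      using \<open>x \<in> G\<close> unfolding G_def by blast
    define g where "g = 1 / real (Suc n) - 1 / real (Suc (Suc n))"
    have "1 / real (Suc (Suc n)) < 1 / real (Suc n)"
      by (rule divide_strict_left_mono) auto
    then have "g > 0" by (simp add: g_def)
    have "\<forall>\<^sub>F N in sequentially. 1 / g \<le> real N"
      by (rule eventually_sequentiallyI[of "nat \<lceil>1 / g\<rceil>"]) linarith
    then have "\<forall>\<^sub>F N in sequentially. c N x \<le> (d - 1 / real (Suc n)) * real N
        \<longrightarrow> c N y \<le> (d - 1 / real (Suc (Suc n))) * real N"
    proof eventually_elim
      case (elim N)
      then have "1 \<le> g * real N" using \<open>g > 0\<close> by (simp add: field_simps)
      then have "(d - 1 / real (Suc n)) * real N + 1 \<le> (d - 1 / real (Suc (Suc n))) * real N"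
        unfolding g_def left_diff_distrib by linarith
      then show ?case using that(2)[of N] by linarith
    qed
    then have "\<exists>\<^sub>F N in sequentially. c N y \<le> (d - 1 / real (Suc (Suc n))) * real N"
      using n by (rule frequently_rev_mp[rotated])
    then show ?thesis unfolding G_def by blast
  qed
  have "T x \<in> G \<longleftrightarrow> x \<in> G" for x
    using G_transfer[of x "T x"] G_transfer[of "T x" x] shift by (smt (verit))
  then have G_inv: "T -` G = G" by auto
  \<comment> \<open>Written with countable quantifiers over \<open>N\<close>, membership in
    \<open>G\<close> is visibly measurable.\<close>
  have "{x \<in> space M. \<exists>n. \<forall>m. \<exists>N\<ge>m. c N x \<le> (d - 1 / real (Suc n)) * real N} \<in> sets M"
    by measurable
  then have G_sets: "G \<in> sets M"
    by (simp add: G_def frequently_sequentially space)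
  have "measure M G \<noteq> 0"
  proof
    assume "measure M G = 0"
    then have "AE x in M. x \<notin> G"
      using G_sets by (simp add: AE_iff_measurable[OF G_sets] emeasure_eq_measure space)
    obtain n where n: "1 / real (Suc n) < d - (1 - measure M E)"
      using reals_Archimedean[of "d - (1 - measure M E)"] E_large by (auto simp: inverse_eq_divide)
    define q where "q = d - 1 / real (Suc n)"
    have q: "measure M (- E) < q"
      using n prob_compl[OF E] by (simp add: q_def space Compl_eq_Diff_UNIV)
    have "AE x in M. ennreal q \<le> liminf (\<lambda>N. ennreal (c N x / real N))"
      using \<open>AE x in M. x \<notin> G\<close>
    proof eventually_elim
      case (elim x)
      then have "\<forall>\<^sub>F N in sequentially. q * real N < c N x"
        by (auto simp: G_def q_def not_frequently not_le)
      then have "\<forall>\<^sub>F N in sequentially. ennreal q \<le> ennreal (c N x / real N)"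
        using eventually_gt_at_top[of 0]
        by eventually_elim (auto intro!: ennreal_leI simp: field_simps)
      then show ?case by (rule Liminf_bounded)
    qed
    then have "ennreal q \<le> (\<integral>\<^sup>+ x. liminf (\<lambda>N. ennreal (c N x / real N)) \<partial>M)"
      using nn_integral_mono_AE[of "\<lambda>_. ennreal q" _ M] by (simp add: emeasure_space_1)
    also have "\<dots> \<le> liminf (\<lambda>N. \<integral>\<^sup>+ x. ennreal (c N x / real N) \<partial>M)"
      by (rule nn_integral_liminf) measurable
    also have "\<dots> \<le> ennreal (measure M (- E))"
    proof -
      \<comment> \<open>By invariance each of the \<open>N\<close> summands of \<open>c N\<close>
        has integral \<open>measure M (- E)\<close>. The value \<open>N = 0\<close> is excluded
        because the quotient is then 0.\<close>
      have "(\<integral>\<^sup>+ x. ennreal (c N x / real N) \<partial>M) = ennreal (measure M (- E))" if "N > 0" for N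
      proof -
        have ind: "integrable M (\<lambda>x. indicator (- E) ((T ^^ i) x) :: real)" for i
          by (rule integrable_const_bound[of _ 1]) (auto simp: indicator_def)
        have "(\<integral>x. indicator (- E) ((T ^^ i) x) \<partial>M) = measure M (- E)" for i
        proof -
          have "(\<integral>x. indicator (- E) ((T ^^ i) x) \<partial>M) = (\<integral>x. indicator ((T ^^ i) -` (- E)) x \<partial>M)"
            by (intro Bochner_Integration.integral_cong) (auto simp: indicator_def)
          also have "\<dots> = measure M ((T ^^ i) -` (- E))" by (simp add: space)
          also have "\<dots> = measure M (- E)"
            by (rule measure_preserving_funpow[OF T space inv E'])
          finally show ?thesis .
        qed
        then have "(\<integral>x. c N x / real N \<partial>M) = measure M (- E)"
          unfolding c_def using ind that by simp
        moreover have "integrable M (\<lambda>x. c N x / real N)"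
          unfolding c_def using ind by auto
        moreover have "0 \<le> c N x / real N" for x
          by (simp add: c_card)
        ultimately show ?thesis by (subst nn_integral_eq_integral) auto
      qed
      then have "\<forall>\<^sub>F N in sequentially.
          (\<integral>\<^sup>+ x. ennreal (c N x / real N) \<partial>M) \<le> ennreal (measure M (- E))"
        by (intro eventually_mono[OF eventually_gt_at_top[of 0]]) simp
      then have "limsup (\<lambda>N. \<integral>\<^sup>+ x. ennreal (c N x / real N) \<partial>M) \<le> ennreal (measure M (- E))"
        by (rule Limsup_bounded)
      then show ?thesis using Liminf_le_Limsup[OF sequentially_bot] order_trans by blast
    qed
    finally have "q \<le> measure M (- E)" by (simp add: ennreal_le_iff)
    with q show False by simp
  qed
  then have "measure M G = 1" using erg[OF G_sets G_inv] by blast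
  then have "AE x in M. x \<in> G" using G_sets by (simp add: prob_eq_1)
  then show ?thesis
  proof eventually_elim
    case (elim x)
    then obtain n where "\<exists>\<^sub>F N in sequentially. c N x \<le> (d - 1 / real (Suc n)) * real N"
      unfolding G_def by blast
    moreover have "(d - 1 / real (Suc n)) * real N \<le> d * real N" for N
      by (intro mult_right_mono) auto
    ultimately show ?case
      unfolding c_card by (auto elim!: frequently_elim1 intro: order_trans)
  qed
qed

lemma comeager_distr_irregular_ergodic:
  fixes T :: "'a::{real_normed_vector, second_countable_topology} \<Rightarrow> 'a"
  assumes T: "bounded_linear T" and M: "ergodic_full_support T M"
    and nontriv: "(UNIV :: 'a set) \<noteq> {0}"
  shows "comeager {x. distr_irregular T x}"
proof -
  have "prob_space M" and sets: "sets M = sets borel"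
    and inv: "\<And>A. A \<in> sets M \<Longrightarrow> measure M (T -` A) = measure M A"
    and erg: "\<And>A. A \<in> sets M \<Longrightarrow> T -` A = A \<Longrightarrow> measure M A = 0 \<or> measure M A = 1"
    and supp: "\<And>U. open U \<Longrightarrow> U \<noteq> {} \<Longrightarrow> measure M U > 0"
    using M unfolding ergodic_full_support_def by auto
  interpret prob_space M by fact
  have space: "space M = UNIV" using sets_eq_imp_space_eq[OF sets] by simp
  have open_sets: "U \<in> sets M" if "open U" for U using that by (simp add: sets)
  have lin: "linear (T ^^ i)" for i
    using bounded_linear_funpow[OF T] by (rule bounded_linear.linear)
  have cont: "continuous_on UNIV (T ^^ i)" for i
    using bounded_linear_funpow[OF T] by (rule linear_continuous_on)
  have "T \<in> borel_measurable borel"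
    using T by (intro borel_measurable_continuous_onI linear_continuous_on)
  then have T_meas: "T \<in> measurable M M"
    using measurable_cong_sets[OF sets sets] by simp
  \<comment> \<open>\<open>{0}\<close> itself need not be strictly invariant, but the union of its
    iterated preimages is. These increase because \<open>T 0 = 0\<close> and all have the measure of
    \<open>{0}\<close>, which is therefore 0 or 1. Full support, applied to the nonempty open set
    \<open>- {0}\<close>, rules out 1.\<close>
  have null: "measure M {0} = 0"
  proof -
    define Z where "Z n = (T ^^ n) -` {0}" for n
    have Z_sets: "Z n \<in> sets M" for n
      unfolding Z_def sets using cont[of n]
      by (intro borel_closed closed_vimage) auto
    have T0: "T 0 = 0" using linear_0[OF lin[of 1]] by simp
    have Z_Suc: "Z (Suc n) = T -` Z n" for n
      by (simp add: Z_def funpow_Suc_right vimage_comp del: funpow.simps)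
    have inc: "incseq Z"
      by (rule incseq_SucI) (auto simp: Z_def T0)
    have "T -` (\<Union>n. Z n) = (\<Union>n. Z (Suc n))"
      by (simp add: Z_Suc vimage_Union)
    also have "\<dots> = (\<Union>n. Z n)"
      using inc by (auto simp: incseq_Suc_iff)
    finally have "measure M (\<Union>n. Z n) = 0 \<or> measure M (\<Union>n. Z n) = 1"
      using Z_sets by (intro erg) auto
    moreover have "measure M (Z n) = measure M {0}" for n
      unfolding Z_def by (rule measure_preserving_funpow[OF T_meas space inv]) (auto simp: sets)
    then have "(\<lambda>n::nat. measure M {0}) \<longlonglongrightarrow> measure M (\<Union>n. Z n)"
      using finite_Lim_measure_incseq[of Z] Z_sets inc by (simp add: image_subset_iff)
    then have "measure M (\<Union>n. Z n) = measure M {0}"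
      by (simp add: LIMSEQ_const_iff)
    moreover have "measure M {0} \<noteq> 1"
    proof
      assume "measure M {0} = 1"
      then have "measure M (- {0}) = 0"
        using prob_compl[of "{0}"] by (simp add: sets space Compl_eq_Diff_UNIV)
      moreover have "measure M (- {0}) > 0" using nontriv by (intro supp) auto
      ultimately show False by simp
    qed
    ultimately show ?thesis by auto
  qed
  (* Typical points of the dilates of M are dense as well, since T commutes with dilations:
     the factor s may thus depend on E while U stays arbitrary. *)
  have visits: "\<exists>x\<in>U. \<exists>N>n. real (card {i \<in> {1..N}. (T ^^ i) x \<notin> (\<lambda>y. s *\<^sub>R y) ` E}) \<le> d * real N"
    if U: "open U" "U \<noteq> {}" and s: "s > 0" and E: "E \<in> sets M" "1 - d < measure M E"
    for U n and s d :: real and E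
  proof -
    define V where "V = (\<lambda>y. s *\<^sub>R y) -` U"
    have "open V" unfolding V_def using U(1) by (intro open_vimage continuous_intros)
    obtain u where "u \<in> U" using U(2) by blast
    then have "(1 / s) *\<^sub>R u \<in> V" using s by (simp add: V_def)
    then have "measure M V > 0" using \<open>open V\<close> by (intro supp) auto
    have "AE x in M. \<exists>\<^sub>F N in sequentially. real (card {i \<in> {1..N}. (T ^^ i) x \<notin> E}) \<le> d * real N"
      by (rule ergodic_frequent_visits[OF prob_space_axioms space T_meas inv erg E])
    \<comment> \<open>As \<open>V\<close> has positive measure, it contains a typical point
      \<open>x\<close>, and its dilate \<open>s *\<^sub>R x\<close> lies in
      \<open>U\<close>.\<close>
    moreover have "\<not> (AE x in M. x \<notin> V)"
      using \<open>measure M V > 0\<close> open_sets[OF \<open>open V\<close>]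
      by (simp add: AE_iff_measurable[OF open_sets[OF \<open>open V\<close>]] emeasure_eq_measure space)
    ultimately obtain x where "x \<in> V"
      and x: "\<exists>\<^sub>F N in sequentially. real (card {i \<in> {1..N}. (T ^^ i) x \<notin> E}) \<le> d * real N"
      by (smt (verit) eventually_mono)
    then obtain N where N: "N > n" "real (card {i \<in> {1..N}. (T ^^ i) x \<notin> E}) \<le> d * real N"
      unfolding frequently_sequentially using Suc_le_eq by blast
    have "(T ^^ i) (s *\<^sub>R x) \<notin> (\<lambda>y. s *\<^sub>R y) ` E \<longleftrightarrow> (T ^^ i) x \<notin> E" for i
      using s by (auto simp: linear_cmul[OF lin])
    with N \<open>x \<in> V\<close> show ?thesis
      by (intro bexI[of _ "s *\<^sub>R x"] exI[of _ N]) (auto simp: V_def)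
  qed
  have fewer: "card {i \<in> {1..N}. \<not> P i} \<le> card {i \<in> {1..N}. \<not> Q i}" if "\<And>i. Q i \<Longrightarrow> P i" for N :: nat and P Q
    using that by (intro card_mono) auto
  show ?thesis
  proof (rule comeager_distr_irregular[OF cont])
    fix U :: "'a set" and n :: nat and e :: real
    assume U: "open U" "U \<noteq> {}" and e: "0 < e"
    \<comment> \<open>A ball of large radius \<open>k\<close> carries almost all of the mass, and
      dilation by \<open>e / k\<close> brings it into the ball of radius \<open>e\<close>.
      Positivity of \<open>k\<close> is kept for this division.\<close>
    have "(\<lambda>k. measure M (ball 0 (real k))) \<longlonglongrightarrow> measure M (\<Union>k. ball 0 (real k))"
      by (rule finite_Lim_measure_incseq) (auto simp: sets incseq_def)
    moreover have "(\<Union>k. ball (0::'a) (real k)) = UNIV"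
      using reals_Archimedean2 by auto
    ultimately have "(\<lambda>k. measure M (ball 0 (real k))) \<longlonglongrightarrow> 1"
      using prob_space space by simp
    then have "\<forall>\<^sub>F k in sequentially. 1 - e < measure M (ball 0 (real k)) \<and> k > 0"
      using e by (intro eventually_conj order_tendstoD eventually_gt_at_top) auto
    then obtain k where k: "1 - e < measure M (ball 0 (real k))" "k > 0"
      using eventually_happens'[OF sequentially_bot] by blast
    obtain x N where "x \<in> U" "N > n"
      and N: "real (card {i \<in> {1..N}. (T ^^ i) x \<notin> (\<lambda>y. (e / real k) *\<^sub>R y) ` ball 0 (real k)}) \<le> e * real N"
      using visits[OF U, of "e / real k" "ball 0 (real k)" e n] k e by (auto simp: sets)
    have "norm y < e" if "y \<in> (\<lambda>y. (e / real k) *\<^sub>R y) ` ball 0 (real k)" for y :: 'a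
      using that k(2) e by (auto simp: field_simps)
    then have "card {i \<in> {1..N}. \<not> norm ((T ^^ i) x) < e}
        \<le> card {i \<in> {1..N}. (T ^^ i) x \<notin> (\<lambda>y. (e / real k) *\<^sub>R y) ` ball 0 (real k)}"
      by (rule fewer)
    with N have "real (card {i \<in> {1..N}. \<not> norm ((T ^^ i) x) < e}) \<le> e * real N" by linarith
    with \<open>x \<in> U\<close> \<open>N > n\<close>
    show "\<exists>x\<in>U. \<exists>N>n. real (card {i \<in> {1..N}. \<not> norm ((T ^^ i) x) < e}) \<le> e * real N" by blast
  next
    fix U :: "'a set" and n :: nat and e K :: real
    assume U: "open U" "U \<noteq> {}" and e: "0 < e" and K: "0 < K"
    \<comment> \<open>These sets exhaust the complement of the origin, which has full measure by
      \<open>null\<close>. Dilation by \<open>K * real (Suc k)\<close> moves \<open>R k\<close>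
      beyond norm \<open>K\<close>.\<close>
    define R where "R k = {y::'a. 1 / real (Suc k) < norm y}" for k
    have R_open: "open (R k)" for k
      unfolding R_def by (intro open_Collect_less continuous_intros)
    have R_inc: "incseq R"
    proof (rule incseq_SucI)
      have "1 / real (Suc (Suc k)) < 1 / real (Suc k)" for k
        by (rule divide_strict_left_mono) auto
      then show "R k \<subseteq> R (Suc k)" for k unfolding R_def by (auto intro: less_trans)
    qed
    have "(\<lambda>k. measure M (R k)) \<longlonglongrightarrow> measure M (\<Union>k. R k)"
      using R_open R_inc by (intro finite_Lim_measure_incseq) (auto simp: sets)
    moreover have "(\<Union>k. R k) = - {0}"
    proof (intro equalityI subsetI)
      fix y :: 'a assume "y \<in> - {0}"
      then obtain k where "inverse (real (Suc k)) < norm y"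
        using reals_Archimedean[of "norm y"] by auto
      then show "y \<in> (\<Union>k. R k)" by (auto simp: R_def inverse_eq_divide)
    qed (auto simp: R_def)
    moreover have "measure M (- {0}) = 1"
      using prob_compl[of "{0}"] null by (simp add: sets space Compl_eq_Diff_UNIV)
    ultimately have "(\<lambda>k. measure M (R k)) \<longlonglongrightarrow> 1" by simp
    then have "\<forall>\<^sub>F k in sequentially. 1 - e < measure M (R k)"
      using e by (intro order_tendstoD) auto
    then obtain k where k: "1 - e < measure M (R k)"
      using eventually_happens'[OF sequentially_bot] by blast
    obtain x N where "x \<in> U" "N > n"
      and N: "real (card {i \<in> {1..N}. (T ^^ i) x \<notin> (\<lambda>y. (K * real (Suc k)) *\<^sub>R y) ` R k}) \<le> e * real N"
      using visits[OF U _ open_sets[OF R_open] k, of "K * real (Suc k)" n] K by auto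
    have "K < norm y" if y: "y \<in> (\<lambda>y. (K * real (Suc k)) *\<^sub>R y) ` R k" for y :: 'a
    proof -
      obtain w where w: "y = (K * real (Suc k)) *\<^sub>R w" "1 / real (Suc k) < norm w"
        using y unfolding R_def by blast
      have "1 < real (Suc k) * norm w" using w(2) by (simp add: field_simps)
      then have "K * 1 < K * (real (Suc k) * norm w)" using K by (rule mult_strict_left_mono)
      then show ?thesis using K by (simp add: w(1) abs_mult mult.assoc)
    qed
    then have "card {i \<in> {1..N}. \<not> K < norm ((T ^^ i) x)}
        \<le> card {i \<in> {1..N}. (T ^^ i) x \<notin> (\<lambda>y. (K * real (Suc k)) *\<^sub>R y) ` R k}"
      by (rule fewer)
    with N have "real (card {i \<in> {1..N}. \<not> K < norm ((T ^^ i) x)}) \<le> e * real N" by linarith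
    with \<open>x \<in> U\<close> \<open>N > n\<close>
    show "\<exists>x\<in>U. \<exists>N>n. real (card {i \<in> {1..N}. \<not> K < norm ((T ^^ i) x)}) \<le> e * real N" by blast
  qed
qed

theorem theorem1p5:
  fixes T :: "'a::{banach, second_countable_topology} \<Rightarrow> 'a"
  assumes "bounded_linear T"
    and "\<not> (\<exists>B. finite B \<and> span B = (UNIV :: 'a set))"
  shows "((\<exists>M. ergodic_full_support T M) \<longrightarrow> comeager {x. distr_irregular T x}) \<and>
         (\<forall>sc. complex_structure sc \<and> (\<forall>c x. T (sc c x) = sc c (T x)) \<and> perfectly_spanning sc T
            \<longrightarrow> comeager {x. distr_irregular T x})"
proof -
  \<comment> \<open>The zero space would be spanned by the empty set, contrary to infinite
    dimension.\<close>
  have "(UNIV :: 'a set) \<noteq> {0}"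
    using assms(2) by (metis finite.emptyI span_empty)
  then show ?thesis
    using comeager_distr_irregular_ergodic[OF assms(1)]
      comeager_distr_irregular_perfectly_spanning[OF assms(1)] by blast
qed

end
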